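(* Let $n\ge 2$ be an even integer, let $J_n$ be the set of involutions in $S_n$ with no fixed points, and let $$\mathcal{J}_n^{d}(t)=\sum_{\sigma\in J_n}t^{d(\sigma)}.$$ For all integers $i$ with $1\le i\le n^{0.925}/10$, $$[t^i]\mathcal{J}_n^{d}(t)<[t^{i+1}]\mathcal{J}_n^{d}(t)\qquad\text{and}\qquad [t^{n-1-i}]\mathcal{J}_n^{d}(t)>[t^{n-i}]\mathcal{J}_n^{d}(t).$$
   Context: $S_n$ is the symmetric group on $\{1,\dots,n\}$, with $\sigma_i=\sigma(i)$. $J_n=\{\sigma\in S_n:\sigma^2=\mathrm{id},\ \sigma_i\ne i\text{ for all }i\}$. The number of descents is $d(\sigma)=|\{i:1\le i<n,\ \sigma_i>\sigma_{i+1}\}|$. $[t^i]P(t)$ denotes the coefficient of $t^i$ in $P(t)$. *)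

theory Defs
  imports
    Complex_Main
    "HOL-Combinatorics.Permutations"
    "HOL-Computational_Algebra.Polynomial"
begin

text \<open>
  An element of the symmetric group on \<open>{1..n}\<close> is a function \<open>nat \<Rightarrow> nat\<close> with
  \<^term>\<open>\<sigma> permutes {1..n}\<close>; it is the identity outside \<open>{1..n}\<close>, so the absence of
  fixed points has to be restricted to \<open>{1..n}\<close>.
\<close>

definition fpf_involutions :: "nat \<Rightarrow> (nat \<Rightarrow> nat) set" where
  "fpf_involutions n = {\<sigma>. \<sigma> permutes {1..n} \<and> \<sigma> \<circ> \<sigma> = id \<and> (\<forall>i\<in>{1..n}. \<sigma> i \<noteq> i)}"

definition descents :: "nat \<Rightarrow> (nat \<Rightarrow> nat) \<Rightarrow> nat" where
  "descents n \<sigma> = card {i. 1 \<le> i \<and> i < n \<and> \<sigma> i > \<sigma> (i + 1)}"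

definition descent_poly :: "nat \<Rightarrow> int poly" where
  "descent_poly n = (\<Sum>\<sigma>\<in>fpf_involutions n. monom 1 (descents n \<sigma>))"

end

theory Submission
  imports Defs "HOL-Library.Product_Lexorder" "HOL-Library.FuncSet"
begin

text \<open>
  Write \<open>n = 2 * m\<close> and let \<open>a\<^sub>m(k)\<close> be the number of fixed-point-free involutions of
  \<open>{1..n}\<close> with \<open>k\<close> descents.  In fact \<open>a\<^sub>m(1) < a\<^sub>m(2) < \<dots> < a\<^sub>m(m)\<close> as soon as \<open>m \<ge> 3\<close>, and
  \<open>a\<^sub>m(n - k) = a\<^sub>m(k)\<close>.  A positive \<open>i\<close> with \<open>i \<le> n\<^bsup>0.925\<^esup> / 10 \<le> n / 10\<close> satisfies
  \<open>i + 1 \<le> m\<close> and forces \<open>m \<ge> 3\<close>, so the first inequality is one step of this chain and the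
  second is its mirror image.

  The chain rests on the three-term recurrence of Guo and Zeng, with \<open>N = 2 * m + 2\<close>,
  \<open>N a\<^sub>m\<^sub>+\<^sub>1(k) = (k(k+1) + N-2) a\<^sub>m(k) + 2((k-1)(N-k-1) + 1) a\<^sub>m(k-1) +
  ((N-k)(N-k+1) + N-2) a\<^sub>m(k-2)\<close>
  (\<open>descent_count_rec\<close>).  Its coefficients are invariant under \<open>k \<mapsto> N - k\<close>, which gives the
  symmetry.  Taking differences \<open>d\<^sub>m(k) = a\<^sub>m(k) - a\<^sub>m(k-1)\<close> yields a recurrence of the same shape
  whose coefficients are nonnegative up to the middle, so positivity of \<open>d\<^sub>m\<close> propagates by
  induction on \<open>m\<close>; only the middle index needs the symmetry as well, because there the recurrence
  looks one step past the centre of the previous row.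

  The recurrence is read off from the identity
  \<open>\<Sum>\<^sub>k a\<^sub>m(k) (r - k + n choose n) = (r(r+1)/2 + m - 1 choose m)\<close>, valid for all \<open>r\<close>
  (\<open>sum_fpf_involutions_choose\<close>), a special case of a theorem of Gessel and Reutenauer:
  multiplying the right-hand side by \<open>r(r+1)/2 + m\<close> gives \<open>m + 1\<close> times its successor in \<open>m\<close>,
  and the binomial coefficients on the left are linearly independent as functions of \<open>r\<close>.

  Both sides of the identity count the same objects.  The left side counts pairs of an involution
  \<open>\<sigma>\<close> and a weakly increasing sequence \<open>s\<close> with values in \<open>{0..r}\<close> that increases strictly at the
  descents of \<open>\<sigma>\<close>.  The right side counts multisets of \<open>m\<close> pairs \<open>a < b \<le> r\<close>, equivalently
  multisets of \<open>n\<close> pairs that are invariant under swapping coordinates and avoid the diagonal.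
  The map \<open>(\<sigma>, s) \<mapsto> {(s i, s (\<sigma> i)) | i}\<close> is a bijection between the two: listing the pairs in
  lexicographic order recovers \<open>s\<close> as the list of first coordinates, and \<open>\<sigma>\<close> as the permutation that
  stably sorts the list of second coordinates.
\<close>

section \<open>Monotone enumerations of multisets\<close>

text \<open>
  Together with the next lemma: a multiset of size \<open>n\<close> in a linear order is the same as a
  weakly increasing function on \<open>{1..n}\<close>.  This is the sorting of lists, rephrased for functions
  on positions so that permutations of the positions can act on them.
\<close>
lemma mono_enumeration_unique:
  fixes p q :: "nat \<Rightarrow> 'a::linorder"
  assumes "mono_on {1..n} p" "mono_on {1..n} q"
    and eq: "image_mset p (mset_set {1..n}) = image_mset q (mset_set {1..n})"
    and i: "i \<in> {1..n}"
  shows "p i = q i"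
proof -
  have srt: "sorted (map f [1..<Suc n])" if "mono_on {1..n} f" for f :: "nat \<Rightarrow> 'a"
    unfolding sorted_iff_nth_mono using that
    by (auto simp del: upt_Suc intro!: mono_onD[OF that])
  have ms: "mset (map f [1..<Suc n]) = image_mset f (mset_set {1..n})" for f :: "nat \<Rightarrow> 'a"
    by (simp del: upt_Suc add: atLeastLessThanSuc_atLeastAtMost)
  have "map p [1..<Suc n] = map q [1..<Suc n]"
    using properties_for_sort[of "map p [1..<Suc n]" "map q [1..<Suc n]"]
      properties_for_sort[of "map q [1..<Suc n]" "map q [1..<Suc n]"] srt assms(1,2) ms eq
    by metis
  thus ?thesis using i by (auto simp del: upt_Suc)
qed

lemma mono_enumeration_exists:
  fixes M :: "'a::linorder multiset"
  assumes "size M = n"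
  obtains p where "mono_on {1..n} p" "image_mset p (mset_set {1..n}) = M"
proof
  define xs where "xs = sorted_list_of_multiset M"
  have len: "length xs = n" using assms
    by (metis mset_sorted_list_of_multiset size_mset xs_def)
  define p where "p i = xs ! (i - 1)" for i
  show "mono_on {1..n} p"
    unfolding p_def using len
    by (intro mono_onI sorted_nth_mono) (auto simp: xs_def)
  have "image_mset p (mset_set {1..n}) = mset (map p [1..<Suc n])"
    by (simp del: upt_Suc add: atLeastLessThanSuc_atLeastAtMost)
  also have "map p [1..<Suc n] = xs"
    by (rule nth_equalityI) (auto simp: len p_def simp del: upt_Suc)
  also have "mset xs = M" by (simp add: xs_def)
  finally show "image_mset p (mset_set {1..n}) = M" .
qed

lemma card_mono_PiE:
  "card {t \<in> {1..n} \<rightarrow>\<^sub>E {0..q::nat}. mono_on {1..n} t} = (q + n choose n)"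
proof -
  let ?A = "{t \<in> {1..n} \<rightarrow>\<^sub>E {0..q}. mono_on {1..n} t}"
  let ?f = "\<lambda>t. image_mset t (mset_set {1..n})"
  have "bij_betw ?f ?A (multisets_of_size {0..q} n)"
  proof (rule bij_betw_imageI)
    show "inj_on ?f ?A"
    proof (rule inj_onI)
      fix s t assume st: "s \<in> ?A" "t \<in> ?A" "?f s = ?f t"
      have "s i = t i" if "i \<in> {1..n}" for i
        using st that by (intro mono_enumeration_unique[of n s t]) blast+
      thus "s = t" using st by (intro PiE_ext[of s "{1..n}" "\<lambda>_. {0..q}" t]) blast+
    qed
    show "?f ` ?A = multisets_of_size {0..q} n"
    proof (intro equalityI subsetI)
      fix M assume "M \<in> ?f ` ?A"
      thus "M \<in> multisets_of_size {0..q} n"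
        by (fastforce simp: multisets_of_size_def PiE_iff)
    next
      fix M assume M: "M \<in> multisets_of_size {0..q} n"
      then obtain p where p: "mono_on {1..n} p" "?f p = M"
        using mono_enumeration_exists[of M n] by (auto simp: multisets_of_size_def)
      have "set_mset M = p ` {1..n}" using p(2) by auto
      hence "restrict p {1..n} \<in> ?A"
        using p(1) M by (auto simp: multisets_of_size_def mono_on_def)
      moreover have "?f (restrict p {1..n}) = M"
        unfolding p(2)[symmetric] by (rule image_mset_cong) auto
      ultimately show "M \<in> ?f ` ?A" by (intro image_eqI[where x = "restrict p {1..n}"]) simp_all
    qed
  qed
  hence "card ?A = card (multisets_of_size {0..q} n)" by (rule bij_betw_same_card)
  thus ?thesis by (simp add: card_multisets_of_size)
qed

section \<open>Sequences compatible with a permutation\<close>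

definition compatible :: "nat \<Rightarrow> nat \<Rightarrow> (nat \<Rightarrow> nat) \<Rightarrow> (nat \<Rightarrow> nat) set" where
  "compatible n r \<sigma> = {s \<in> {1..n} \<rightarrow>\<^sub>E {0..r}.
     \<forall>i. 1 \<le> i \<and> i < n \<longrightarrow> s i \<le> s (i + 1) \<and> (\<sigma> i > \<sigma> (i + 1) \<longrightarrow> s i < s (i + 1))}"

lemma mono_on_atLeastAtMost_Suc:
  fixes f :: "nat \<Rightarrow> 'a::order"
  assumes "\<And>i. 1 \<le> i \<Longrightarrow> i < n \<Longrightarrow> f i \<le> f (i + 1)"
  shows "mono_on {1..n} f"
proof (rule mono_onI)
  fix i j assume "i \<in> {1..n}" "j \<in> {1..n}" "i \<le> j"
  from \<open>i \<le> j\<close> \<open>j \<in> {1..n}\<close> show "f i \<le> f j"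
  proof (induction j rule: dec_induct)
    case (step k)
    have "f k \<le> f (k + 1)" using step \<open>i \<in> {1..n}\<close> by (intro assms) auto
    moreover have "f i \<le> f k" using step \<open>i \<in> {1..n}\<close> by auto
    ultimately show ?case by simp
  qed auto
qed

text \<open>
  Subtracting from \<open>s i\<close> the number \<open>D i\<close> of descents before position \<open>i\<close> removes the strictness
  conditions: what is left is an arbitrary weakly increasing sequence whose bound has dropped by the
  total number of descents.
\<close>
lemma card_compatible:
  "card (compatible n r \<sigma>) =
     (if descents n \<sigma> \<le> r then (r - descents n \<sigma> + n choose n) else 0)"
proof -
  define D where "D i = card {j. 1 \<le> j \<and> j < i \<and> \<sigma> j > \<sigma> (j + 1)}" for i
  have D1: "D 1 = 0" by (simp add: D_def)
  have Dn: "D n = descents n \<sigma>" by (simp add: D_def descents_def)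
  have DS: "D (i + 1) = D i + (if \<sigma> i > \<sigma> (i + 1) then 1 else 0)" if "1 \<le> i" for i
  proof -
    have fin: "finite {j. 1 \<le> j \<and> j < i \<and> \<sigma> j > \<sigma> (j + 1)}" by simp
    show ?thesis
    proof (cases "\<sigma> i > \<sigma> (i + 1)")
      case True
      have "{j. 1 \<le> j \<and> j < i + 1 \<and> \<sigma> j > \<sigma> (j + 1)} =
              insert i {j. 1 \<le> j \<and> j < i \<and> \<sigma> j > \<sigma> (j + 1)}"
        using True that by (auto simp: less_Suc_eq)
      thus ?thesis using True fin by (simp add: D_def)
    next
      case False
      have "{j. 1 \<le> j \<and> j < i + 1 \<and> \<sigma> j > \<sigma> (j + 1)} =
              {j. 1 \<le> j \<and> j < i \<and> \<sigma> j > \<sigma> (j + 1)}"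
        using False by (auto simp: less_Suc_eq)
      thus ?thesis using False by (simp add: D_def)
    qed
  qed
  have Dmono: "mono_on {1..n} D"
    by (rule mono_on_atLeastAtMost_Suc) (use DS in auto)
  have D_le: "D i \<le> D n" if "i \<in> {1..n}" for i
    using that by (intro mono_onD[OF Dmono]) auto
  have s_ge: "D i \<le> s i" and s_le: "s i + D n \<le> r + D i"
    if s: "s \<in> compatible n r \<sigma>" and i: "i \<in> {1..n}" for s i
  proof -
    have step: "s j + D (j + 1) \<le> s (j + 1) + D j" if "1 \<le> j" "j < n" for j
      using s that DS[of j] by (auto simp: compatible_def Suc_le_eq)
    have "mono_on {1..n} (\<lambda>j. int (s j) - int (D j))"
      by (rule mono_on_atLeastAtMost_Suc) (use step in force)
    hence "int (s 1) - int (D 1) \<le> int (s i) - int (D i)"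
      "int (s i) - int (D i) \<le> int (s n) - int (D n)"
      using i by (auto simp: mono_on_def)
    moreover have "s n \<le> r" using s i by (auto simp: compatible_def)
    ultimately show "D i \<le> s i" "s i + D n \<le> r + D i" using D1 by linarith+
  qed
  show ?thesis
  proof (cases "descents n \<sigma> \<le> r")
    case False
    have "n \<noteq> 0" using False by (intro notI) (simp add: descents_def)
    have "compatible n r \<sigma> = {}"
    proof (rule ccontr)
      assume "compatible n r \<sigma> \<noteq> {}"
      then obtain s where s: "s \<in> compatible n r \<sigma>" by auto
      have "n \<in> {1..n}" using \<open>n \<noteq> 0\<close> by auto
      hence "D n \<le> s n" "s n \<le> r" using s_ge[OF s] s by (auto simp: compatible_def)
      thus False using False Dn by simp
    qed
    thus ?thesis using False by simp
  next
    case True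
    define q where "q = r - descents n \<sigma>"
    let ?A = "{t \<in> {1..n} \<rightarrow>\<^sub>E {0..q}. mono_on {1..n} t}"
    let ?f = "\<lambda>s. restrict (\<lambda>i. s i - D i) {1..n}"
    let ?g = "\<lambda>t. restrict (\<lambda>i. t i + D i) {1..n}"
    have q: "r = q + D n" using True by (simp add: q_def Dn)
    have "bij_betw ?f (compatible n r \<sigma>) ?A"
    proof (rule bij_betw_byWitness[where f' = ?g])
      show "\<forall>s\<in>compatible n r \<sigma>. ?g (?f s) = s"
      proof (intro ballI ext)
        fix s i assume s: "s \<in> compatible n r \<sigma>"
        show "?g (?f s) i = s i"
          using s s_ge[OF s, of i] by (auto simp: compatible_def PiE_def extensional_def)
      qed
      show "\<forall>t\<in>?A. ?f (?g t) = t"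
        by (auto simp: PiE_def extensional_def fun_eq_iff)
      show "?f ` compatible n r \<sigma> \<subseteq> ?A"
      proof (intro image_subsetI CollectI conjI)
        fix s assume s: "s \<in> compatible n r \<sigma>"
        show "?f s \<in> {1..n} \<rightarrow>\<^sub>E {0..q}"
          using s_le[OF s] q by fastforce
        show "mono_on {1..n} (?f s)"
        proof (rule mono_on_atLeastAtMost_Suc)
          fix i assume i: "1 \<le> i" "i < n"
          have "s i + D (i + 1) \<le> s (i + 1) + D i"
            using s i DS[of i] by (auto simp: compatible_def Suc_le_eq)
          thus "?f s i \<le> ?f s (i + 1)"
            using i s_ge[OF s, of i] s_ge[OF s, of "i + 1"] by auto
        qed
      qed
      show "?g ` ?A \<subseteq> compatible n r \<sigma>"
      proof (rule image_subsetI)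
        fix t assume t: "t \<in> ?A"
        have "t i + D i \<le> r" if "i \<in> {1..n}" for i
          using t that D_le[OF that] q by (fastforce intro: add_mono)
        moreover have "t i \<le> t (i + 1)" if "1 \<le> i" "i < n" for i
          using t that by (auto simp: mono_on_def)
        ultimately show "?g t \<in> compatible n r \<sigma>"
          using DS by (auto simp: compatible_def le_imp_less_Suc add_le_mono)
      qed
    qed
    hence "card (compatible n r \<sigma>) = card ?A" by (rule bij_betw_same_card)
    thus ?thesis unfolding card_mono_PiE using True by (simp add: q_def)
  qed
qed

section \<open>Standardisation of symmetric multisets of pairs\<close>

definition symmetric_multisets :: "nat \<Rightarrow> nat \<Rightarrow> (nat \<times> nat) multiset set" where
  "symmetric_multisets n r = {M. size M = n \<and> set_mset M \<subseteq> {0..r} \<times> {0..r} \<and>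
     image_mset prod.swap M = M \<and> (\<forall>a. (a, a) \<notin># M)}"

text \<open>
  A symmetric multiset off the diagonal is determined by its part above the diagonal, which is an
  arbitrary multiset of half the size.
\<close>
lemma card_symmetric_multisets:
  "card (symmetric_multisets (2 * m) r) = (r * (r + 1) div 2 + m - 1 choose m)"
proof -
  define P :: "(nat \<times> nat) set" where "P = {(a, b). a < b \<and> b \<le> r}"
  have P_eq: "P = prod.swap ` (SIGMA b:{0..r}. {0..<b})"
    unfolding set_eq_iff by (auto simp: P_def pair_in_swap_image)
  have "card P = (\<Sum>b=0..r. b)"
    unfolding P_eq by (subst card_image) (auto simp: inj_on_def)
  hence card_P: "card P = r * (r + 1) div 2"
    using gauss_sum_nat[of r] by simp
  have fin_P: "finite P" unfolding P_eq by auto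
  let ?g = "\<lambda>N::(nat \<times> nat) multiset. N + image_mset prod.swap N"
  let ?h = "filter_mset (\<lambda>(a::nat, b::nat). a < b)"
  have split: "?g (?h M) = M" if "M \<in> symmetric_multisets (2 * m) r" for M
  proof -
    have sw: "image_mset prod.swap M = M" and diag: "\<And>a. (a, a) \<notin># M"
      using that by (auto simp: symmetric_multisets_def)
    have "image_mset prod.swap (?h M) = filter_mset (\<lambda>(a, b). b < a) (image_mset prod.swap M)"
      by (simp add: filter_mset_image_mset case_prod_unfold)
    also have "\<dots> = filter_mset (\<lambda>(a, b). b < a) M" by (simp add: sw)
    also have "\<dots> = filter_mset (\<lambda>x. \<not> (case x of (a, b) \<Rightarrow> a < b)) M"
      by (rule filter_mset_cong) (use diag in \<open>auto simp: linorder_neq_iff not_less order_le_less\<close>)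
    finally show ?thesis by (simp add: multiset_partition[symmetric])
  qed
  have "bij_betw ?h (symmetric_multisets (2 * m) r) (multisets_of_size P m)"
  proof (rule bij_betw_byWitness[where f' = ?g])
    show "\<forall>M\<in>symmetric_multisets (2 * m) r. ?g (?h M) = M" using split by blast
    show "\<forall>N\<in>multisets_of_size P m. ?h (?g N) = N"
    proof
      fix N assume N: "N \<in> multisets_of_size P m"
      hence sub: "a < b" if "(a, b) \<in># N" for a b
        using that by (auto simp: multisets_of_size_def P_def)
      have "?h N = N"
        by (subst filter_mset_eq_conv) (use sub in auto)
      moreover have "?h (image_mset prod.swap N) = {#}"
        by (auto simp: filter_mset_image_mset filter_mset_eq_mempty_iff dest!: sub)
      ultimately show "?h (?g N) = N" by simp
    qed
    show "?h ` symmetric_multisets (2 * m) r \<subseteq> multisets_of_size P m"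
    proof (rule image_subsetI)
      fix M assume M: "M \<in> symmetric_multisets (2 * m) r"
      have "size M = size (?h M) + size (?h M)"
        by (subst split[OF M, symmetric]) (simp del: filter_union_mset)
      thus "?h M \<in> multisets_of_size P m"
        using M by (auto simp: symmetric_multisets_def multisets_of_size_def P_def)
    qed
    show "?g ` multisets_of_size P m \<subseteq> symmetric_multisets (2 * m) r"
      by (auto simp: symmetric_multisets_def multisets_of_size_def P_def multiset.map_comp
            simp flip: mset_map)
         (auto simp: o_def)
  qed
  thus ?thesis
    using bij_betw_same_card[of ?h] by (simp add: card_multisets_of_size fin_P card_P)
qed

text \<open>
  A permutation can be recovered from the order of its values.  For injectivity of the
  standardisation this order is expressed by data that the multiset of pairs determines.
\<close>
lemma permutes_eq_rank:
  assumes "\<sigma> permutes {1..n}" "i \<in> {1..n}"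
  shows "\<sigma> i = card {j\<in>{1..n}. \<sigma> j \<le> \<sigma> i}"
proof -
  have im: "\<sigma> ` {1..n} = {1..n}" using assms(1) by (rule permutes_image)
  have "\<sigma> i \<in> {1..n}" using assms im by blast
  have "\<sigma> ` {j\<in>{1..n}. \<sigma> j \<le> \<sigma> i} = {1..\<sigma> i}"
  proof (intro equalityI subsetI)
    fix x assume "x \<in> {1..\<sigma> i}"
    hence "x \<in> \<sigma> ` {1..n}" using im \<open>\<sigma> i \<in> {1..n}\<close> by auto
    thus "x \<in> \<sigma> ` {j\<in>{1..n}. \<sigma> j \<le> \<sigma> i}" using \<open>x \<in> {1..\<sigma> i}\<close> by auto
  qed (use im in auto)
  moreover have "inj_on \<sigma> {j\<in>{1..n}. \<sigma> j \<le> \<sigma> i}"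
    using permutes_inj[OF assms(1)] by (rule inj_on_subset) simp
  ultimately show ?thesis using card_image by fastforce
qed

lemma ranking_permutes:
  fixes key :: "nat \<Rightarrow> 'a::linorder"
  assumes inj: "inj_on key {1..n}"
  defines "\<rho> \<equiv> \<lambda>i. if i \<in> {1..n} then card {j\<in>{1..n}. key j \<le> key i} else i"
  shows "\<rho> permutes {1..n}"
    and "\<And>i j. i \<in> {1..n} \<Longrightarrow> j \<in> {1..n} \<Longrightarrow> \<rho> i < \<rho> j \<longleftrightarrow> key i < key j"
proof -
  have less: "\<rho> i < \<rho> j" if "i \<in> {1..n}" "j \<in> {1..n}" "key i < key j" for i j
  proof -
    have "j \<in> {k\<in>{1..n}. key k \<le> key j} - {k\<in>{1..n}. key k \<le> key i}"
      using that by auto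
    hence "{k\<in>{1..n}. key k \<le> key i} \<subset> {k\<in>{1..n}. key k \<le> key j}"
      using that(3) by (intro psubsetI) (auto dest: order_trans[OF _ less_imp_le])
    hence "card {k\<in>{1..n}. key k \<le> key i} < card {k\<in>{1..n}. key k \<le> key j}"
      by (intro psubset_card_mono) simp_all
    thus ?thesis using that by (simp add: \<rho>_def)
  qed
  show iff: "\<rho> i < \<rho> j \<longleftrightarrow> key i < key j" if "i \<in> {1..n}" "j \<in> {1..n}" for i j
    using less[of i j] less[of j i] that inj
    by (metis inj_on_contraD linorder_neq_iff order.asym)
  have inj': "inj_on \<rho> {1..n}"
  proof (rule inj_onI)
    fix i j assume ij: "i \<in> {1..n}" "j \<in> {1..n}" "\<rho> i = \<rho> j"
    hence "key i = key j" using iff[of i j] iff[of j i] by auto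
    thus "i = j" using inj ij by (auto dest: inj_onD)
  qed
  have sub: "\<rho> ` {1..n} \<subseteq> {1..n}"
  proof (rule image_subsetI)
    fix i assume i: "i \<in> {1..n}"
    have "card {i} \<le> card {j\<in>{1..n}. key j \<le> key i}"
      using i by (intro card_mono) auto
    moreover have "card {j\<in>{1..n}. key j \<le> key i} \<le> card {1..n}"
      by (intro card_mono) auto
    ultimately show "\<rho> i \<in> {1..n}" using i by (simp add: \<rho>_def)
  qed
  show "\<rho> permutes {1..n}"
  proof (rule bij_imp_permutes)
    show "bij_betw \<rho> {1..n} {1..n}"
      using inj' sub endo_inj_surj[of "{1..n}" \<rho>] by (auto simp: bij_betw_def)
  qed (auto simp: \<rho>_def)
qed

lemma strict_mono_permutes_id:
  fixes \<tau> :: "nat \<Rightarrow> nat"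
  assumes "\<tau> permutes {1..n}"
    and "\<And>i j. i \<in> {1..n} \<Longrightarrow> j \<in> {1..n} \<Longrightarrow> i < j \<Longrightarrow> \<tau> i < \<tau> j"
  shows "\<tau> = id"
proof
  fix i
  show "\<tau> i = id i"
  proof (cases "i \<in> {1..n}")
    case True
    have "mono_on {1..n} \<tau>"
      using assms(2) by (metis mono_onI order.order_iff_strict)
    moreover have "mono_on {1..n} (\<lambda>i. i :: nat)" by (rule mono_onI)
    ultimately show ?thesis
      using mono_enumeration_unique[of n \<tau> "\<lambda>i. i" i] permutes_image_mset[OF assms(1)] True
      by simp
  next
    case False
    thus ?thesis using assms(1) by (simp add: permutes_not_in)
  qed
qed

lemma compatible_mono: "s \<in> compatible n r \<sigma> \<Longrightarrow> mono_on {1..n} s"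
  by (rule mono_on_atLeastAtMost_Suc) (auto simp: compatible_def)

lemma compatible_less:
  assumes "s \<in> compatible n r \<sigma>" "1 \<le> i" "i < n" "\<sigma> i > \<sigma> (i + 1)"
  shows "s i < s (i + 1)"
  using assms by (auto simp: compatible_def)

text \<open>
  Weak monotonicity of \<open>s\<close> keeps it constant between two positions of equal value, and so
  compatibility rules out a descent of \<open>\<sigma>\<close> anywhere between them.
\<close>
lemma compatible_block_increasing:
  assumes "\<sigma> permutes {1..n}" "s \<in> compatible n r \<sigma>"
    and "i \<in> {1..n}" "j \<in> {1..n}" "i < j" "s i = s j"
  shows "\<sigma> i < \<sigma> j"
proof -
  have mono: "mono_on {1..n} s" using assms(2) by (rule compatible_mono)
  from \<open>i < j\<close> have "Suc i \<le> j" by simp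
  thus ?thesis using assms(4,6)
  proof (induction j rule: dec_induct)
    case base
    have "\<sigma> i \<noteq> \<sigma> (i + 1)"
      using permutes_inj[OF assms(1)] by (simp add: inj_eq)
    moreover have "\<not> \<sigma> i > \<sigma> (i + 1)"
      using base assms(2,3) by (auto simp: compatible_def)
    ultimately show ?case by simp
  next
    case (step k)
    have "s i \<le> s k"
      using step.hyps step.prems assms(3) by (intro mono_onD[OF mono]) auto
    moreover have "s k \<le> s (Suc k)"
      using step.hyps step.prems assms(3) by (intro mono_onD[OF mono]) auto
    ultimately have eq: "s i = s k" "s k = s (Suc k)" using step.prems by auto
    have "\<sigma> i < \<sigma> k" using step.IH eq step.prems step.hyps by auto
    moreover have "\<sigma> k \<noteq> \<sigma> (k + 1)"
      using permutes_inj[OF assms(1)] by (simp add: inj_eq)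
    moreover have "\<not> \<sigma> k > \<sigma> (k + 1)"
      using compatible_less[OF assms(2), of k] eq step.hyps step.prems assms(3) by auto
    ultimately show ?case by simp
  qed
qed

lemma finite_fpf_involutions: "finite (fpf_involutions n)"
  by (rule finite_subset[OF _ finite_permutations[of "{1..n}"]]) (auto simp: fpf_involutions_def)

lemma fpf_permutes: "\<sigma> \<in> fpf_involutions n \<Longrightarrow> \<sigma> permutes {1..n}"
  by (simp add: fpf_involutions_def)

lemma fpf_involutive: "\<sigma> \<in> fpf_involutions n \<Longrightarrow> \<sigma> (\<sigma> i) = i"
  by (simp add: fpf_involutions_def fun_eq_iff)

lemma fpf_in_iff: "\<sigma> \<in> fpf_involutions n \<Longrightarrow> \<sigma> i \<in> {1..n} \<longleftrightarrow> i \<in> {1..n}"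
  by (intro permutes_in_image fpf_permutes)

context
  fixes n r :: nat and \<sigma> s :: "nat \<Rightarrow> nat"
  assumes \<sigma>: "\<sigma> \<in> fpf_involutions n" and s: "s \<in> compatible n r \<sigma>"
begin

text \<open>
  The pairs \<open>(s i, s (\<sigma> i))\<close> come in lexicographic order: inside a block of \<open>s\<close> the permutation
  increases, hence so does \<open>s \<circ> \<sigma>\<close>.
\<close>
lemma pairs_mono: "mono_on {1..n} (\<lambda>i. (s i, s (\<sigma> i)))"
proof (rule mono_onI)
  fix i j assume ij: "i \<in> {1..n}" "j \<in> {1..n}" "i \<le> j"
  note mono = compatible_mono[OF s]
  have "s i \<le> s j" using mono ij by (rule mono_onD)
  moreover have "s (\<sigma> i) \<le> s (\<sigma> j)" if "s i = s j"
  proof (cases "i = j")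
    case False
    hence "\<sigma> i < \<sigma> j"
      using compatible_block_increasing[OF fpf_permutes[OF \<sigma>] s] ij that by auto
    moreover have "\<sigma> i \<in> {1..n}" "\<sigma> j \<in> {1..n}" using ij fpf_in_iff[OF \<sigma>] by blast+
    ultimately show ?thesis using mono by (auto simp: mono_on_def)
  qed auto
  ultimately show "(s i, s (\<sigma> i)) \<le> (s j, s (\<sigma> j))"
    unfolding less_eq_prod_simp by linarith
qed

text \<open>
  Two points exchanged by \<open>\<sigma>\<close> cannot lie in one block, since \<open>\<sigma>\<close> increases there but reverses
  them.
\<close>
lemma pairs_neq: 
  assumes "i \<in> {1..n}"
  shows "s i \<noteq> s (\<sigma> i)"
proof
  assume eq: "s i = s (\<sigma> i)"
  have i': "\<sigma> i \<in> {1..n}" using assms fpf_in_iff[OF \<sigma>] by blast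
  have "\<sigma> i \<noteq> i" using \<sigma> assms by (auto simp: fpf_involutions_def)
  then consider "i < \<sigma> i" | "\<sigma> i < i" by linarith
  thus False
  proof cases
    case 1
    thus False using compatible_block_increasing[OF fpf_permutes[OF \<sigma>] s assms i' 1 eq] 1
        by (simp add: fpf_involutive[OF \<sigma>])
  next
    case 2
    thus False using compatible_block_increasing[OF fpf_permutes[OF \<sigma>] s i' assms 2 eq[symmetric]] 2
        by (simp add: fpf_involutive[OF \<sigma>])
  qed
qed

lemma pairs_symmetric:
  "image_mset (\<lambda>i. (s i, s (\<sigma> i))) (mset_set {1..n}) \<in> symmetric_multisets n r"
proof -
  let ?p = "\<lambda>i. (s i, s (\<sigma> i))"
  have "image_mset prod.swap (image_mset ?p (mset_set {1..n})) =
        image_mset (\<lambda>i. ?p (\<sigma> i)) (mset_set {1..n})"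
    by (simp add: multiset.map_comp o_def fpf_involutive[OF \<sigma>])
  also have "\<dots> = image_mset ?p (image_mset \<sigma> (mset_set {1..n}))"
    by (simp add: multiset.map_comp o_def)
  also have "\<dots> = image_mset ?p (mset_set {1..n})"
    by (simp only: permutes_image_mset[OF fpf_permutes[OF \<sigma>]])
  finally have swap: "image_mset prod.swap (image_mset ?p (mset_set {1..n})) =
      image_mset ?p (mset_set {1..n})" .
  have "s i \<in> {0..r}" if "i \<in> {1..n}" for i
    using s that by (auto simp: compatible_def)
  hence "set_mset (image_mset ?p (mset_set {1..n})) \<subseteq> {0..r} \<times> {0..r}"
    using fpf_in_iff[OF \<sigma>] by (auto simp del: atLeastAtMost_iff)
  thus ?thesis
    using swap pairs_neq by (auto simp: symmetric_multisets_def)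
qed

text \<open>
  The permutation that stably sorts the word \<open>s \<circ> \<sigma>\<close> is \<open>\<sigma>\<close> itself.  Ties are broken by
  position because \<open>\<sigma>\<close> is its own inverse, so that the inverse also increases on blocks.
\<close>
lemma fpf_le_iff:
  assumes "i \<in> {1..n}" "j \<in> {1..n}"
  shows "\<sigma> j \<le> \<sigma> i \<longleftrightarrow> (s (\<sigma> j), j) \<le> (s (\<sigma> i), i)"
proof -
  note mono = compatible_mono[OF s]
  have le: "(s (\<sigma> j), j) \<le> (s (\<sigma> i), i)"
    if "\<sigma> j \<le> \<sigma> i" "i \<in> {1..n}" "j \<in> {1..n}" for i j
  proof -
    have in': "\<sigma> i \<in> {1..n}" "\<sigma> j \<in> {1..n}" using that fpf_in_iff[OF \<sigma>] by blast+
    have "s (\<sigma> j) \<le> s (\<sigma> i)" using mono in'(2,1) that(1) by (rule mono_onD)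
    moreover have "j \<le> i" if "s (\<sigma> j) = s (\<sigma> i)"
      using compatible_block_increasing[OF fpf_permutes[OF \<sigma>] s in'(2,1) _ that] \<open>\<sigma> j \<le> \<sigma> i\<close>
      by (metis fpf_involutive[OF \<sigma>] order.order_iff_strict)
    ultimately show ?thesis unfolding less_eq_prod_simp by linarith
  qed
  show ?thesis
    using le[of j i] le[of i j] assms
    by (metis antisym fpf_involutive[OF \<sigma>] linorder_linear prod.inject)
qed

end

lemma standardisation_inj:
  "inj_on (\<lambda>(\<sigma>, s). image_mset (\<lambda>i. (s i, s (\<sigma> i))) (mset_set {1..n}))
     (Sigma (fpf_involutions n) (compatible n r))"
proof (rule inj_onI, clarify)
  fix \<sigma> s \<sigma>' s'
  assume \<sigma>: "\<sigma> \<in> fpf_involutions n" and s: "s \<in> compatible n r \<sigma>"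
    and \<sigma>': "\<sigma>' \<in> fpf_involutions n" and s': "s' \<in> compatible n r \<sigma>'"
    and eq: "image_mset (\<lambda>i. (s i, s (\<sigma> i))) (mset_set {1..n}) =
             image_mset (\<lambda>i. (s' i, s' (\<sigma>' i))) (mset_set {1..n})"
  have pq: "s i = s' i" "s (\<sigma> i) = s' (\<sigma>' i)" if "i \<in> {1..n}" for i
    using mono_enumeration_unique[OF pairs_mono[OF \<sigma> s] pairs_mono[OF \<sigma>' s'] eq that] by auto
  have "s = s'"
    by (rule PiE_ext[of s "{1..n}" "\<lambda>_. {0..r}" s']) (use s s' pq in \<open>auto simp: compatible_def\<close>)
  moreover have "\<sigma> i = \<sigma>' i" for i
  proof (cases "i \<in> {1..n}")
    case True
    have "\<sigma> i = card {j\<in>{1..n}. \<sigma> j \<le> \<sigma> i}"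
      by (rule permutes_eq_rank[OF fpf_permutes[OF \<sigma>] True])
    also have "{j\<in>{1..n}. \<sigma> j \<le> \<sigma> i} = {j\<in>{1..n}. \<sigma>' j \<le> \<sigma>' i}"
      using fpf_le_iff[OF \<sigma> s True] fpf_le_iff[OF \<sigma>' s' True] pq(2) True by auto
    also have "card \<dots> = \<sigma>' i"
      by (rule permutes_eq_rank[OF fpf_permutes[OF \<sigma>'] True, symmetric])
    finally show ?thesis .
  next
    case False
    thus ?thesis
      using permutes_not_in[OF fpf_permutes[OF \<sigma>]] permutes_not_in[OF fpf_permutes[OF \<sigma>']] by simp
  qed
  ultimately show "\<sigma> = \<sigma>' \<and> s = s'" by auto
qed

text \<open>
  List \<open>M\<close> lexicographically as \<open>(u i, w i)\<close> and let \<open>\<sigma>\<close> be the stable sorting permutation of \<open>w\<close>.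
  Carrying the swapped pairs \<open>(w i, u i)\<close> to the positions \<open>\<sigma> i\<close> lists them lexicographically as
  well; as \<open>M\<close> is symmetric, this is the original list, so \<open>u (\<sigma> i) = w i\<close> and
  \<open>w (\<sigma> i) = u i\<close>.  It follows that \<open>\<sigma> \<circ> \<sigma>\<close> preserves the order of positions and is therefore
  the identity, and that a fixed point would put a diagonal pair into \<open>M\<close>.
\<close>
lemma standardisation_surj:
  assumes M: "M \<in> symmetric_multisets n r"
  obtains \<sigma> s where "\<sigma> \<in> fpf_involutions n" "s \<in> compatible n r \<sigma>"
    "image_mset (\<lambda>i. (s i, s (\<sigma> i))) (mset_set {1..n}) = M"
proof -
  have size: "size M = n" and sub: "set_mset M \<subseteq> {0..r} \<times> {0..r}"
    and swap: "image_mset prod.swap M = M" and diag: "\<And>a. (a, a) \<notin># M"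
    using M by (auto simp: symmetric_multisets_def)
  obtain p where p: "mono_on {1..n} p" and pM: "image_mset p (mset_set {1..n}) = M"
    using mono_enumeration_exists[OF size] .
  define u where "u i = fst (p i)" for i
  define w where "w i = snd (p i)" for i
  have p_eq: "p i = (u i, w i)" for i by (simp add: u_def w_def)
  define key where "key i = (w i, i)" for i
  have inj: "inj_on key {1..n}" by (auto simp: key_def inj_on_def)
  define \<sigma> where "\<sigma> = (\<lambda>i. if i \<in> {1..n} then card {j\<in>{1..n}. key j \<le> key i} else i)"
  have perm: "\<sigma> permutes {1..n}" and
    less_iff: "\<And>i j. i \<in> {1..n} \<Longrightarrow> j \<in> {1..n} \<Longrightarrow> \<sigma> i < \<sigma> j \<longleftrightarrow> key i < key j"
    using ranking_permutes[OF inj] unfolding \<sigma>_def by blast+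
  have in_iff: "\<sigma> i \<in> {1..n} \<longleftrightarrow> i \<in> {1..n}" for i
    using permutes_in_image[OF perm] .
  have p_le: "u i < u j \<or> u i = u j \<and> w i \<le> w j"
    if "i \<in> {1..n}" "j \<in> {1..n}" "i \<le> j" for i j
    using mono_onD[OF p that] by (auto simp: p_eq)
  \<comment> \<open>The swapped pair of position \<open>i\<close>, placed at position \<open>\<sigma> i\<close>.\<close>
  let ?\<tau> = "inv \<sigma>"
  have perm': "?\<tau> permutes {1..n}" using perm by (rule permutes_inv)
  have q_mono: "mono_on {1..n} (\<lambda>x. (w (?\<tau> x), u (?\<tau> x)))"
  proof (rule mono_onI)
    fix x y assume xy: "x \<in> {1..n}" "y \<in> {1..n}" "x \<le> y"
    define i j where "i = ?\<tau> x" and "j = ?\<tau> y"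
    have ij: "i \<in> {1..n}" "j \<in> {1..n}"
      using xy permutes_in_image[OF perm'] unfolding i_def j_def by blast+
    have "\<sigma> i = x" "\<sigma> j = y"
      using permutes_inverses(1)[OF perm] by (simp_all add: i_def j_def)
    hence "\<not> key j < key i" using less_iff[OF ij(2,1)] xy by simp
    hence "w i < w j \<or> w i = w j \<and> i \<le> j" by (auto simp: key_def)
    hence "(w i, u i) \<le> (w j, u j)" using p_le[OF ij] by auto
    thus "(w (?\<tau> x), u (?\<tau> x)) \<le> (w (?\<tau> y), u (?\<tau> y))" by (simp add: i_def j_def)
  qed
  have "image_mset (\<lambda>x. (w (?\<tau> x), u (?\<tau> x))) (mset_set {1..n}) =
        image_mset (\<lambda>i. (w i, u i)) (image_mset ?\<tau> (mset_set {1..n}))"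
    by (simp add: multiset.map_comp o_def)
  also have "\<dots> = image_mset prod.swap (image_mset p (mset_set {1..n}))"
    unfolding permutes_image_mset[OF perm'] by (simp add: multiset.map_comp o_def p_eq)
  finally have q_M: "image_mset (\<lambda>x. (w (?\<tau> x), u (?\<tau> x))) (mset_set {1..n}) =
      image_mset p (mset_set {1..n})"
    using swap pM by simp
  have p_\<sigma>: "u (\<sigma> i) = w i" "w (\<sigma> i) = u i" if "i \<in> {1..n}" for i
    using mono_enumeration_unique[OF q_mono p q_M, of "\<sigma> i"] that in_iff[of i]
      permutes_inverses(2)[OF perm] by (simp_all add: p_eq)
  have "\<sigma> \<circ> \<sigma> = id"
  proof (rule strict_mono_permutes_id)
    show "(\<sigma> \<circ> \<sigma>) permutes {1..n}" using perm perm by (rule permutes_compose)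
    fix i j assume ij: "i \<in> {1..n}" "j \<in> {1..n}" "i < j"
    have "u i < u j \<or> u i = u j \<and> key i < key j"
      using p_le[OF ij(1,2)] ij(3) by (auto simp: key_def)
    hence "u i < u j \<or> u i = u j \<and> \<sigma> i < \<sigma> j" using less_iff ij by blast
    hence "key (\<sigma> i) < key (\<sigma> j)" using p_\<sigma> ij by (auto simp: key_def)
    thus "(\<sigma> \<circ> \<sigma>) i < (\<sigma> \<circ> \<sigma>) j" using less_iff[of "\<sigma> i" "\<sigma> j"] in_iff ij by simp
  qed
  moreover have "\<sigma> i \<noteq> i" if "i \<in> {1..n}" for i
  proof
    assume "\<sigma> i = i"
    hence "p i = (w i, w i)" using p_\<sigma>[OF that] by (simp add: p_eq)
    moreover have "p i \<in># M" using that by (auto simp flip: pM)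
    ultimately show False using diag by metis
  qed
  ultimately have "\<sigma> \<in> fpf_involutions n" using perm by (simp add: fpf_involutions_def)
  moreover have "restrict u {1..n} \<in> compatible n r \<sigma>"
  proof -
    have "u i \<in> {0..r}" if "i \<in> {1..n}" for i
    proof -
      have "p i \<in># M" using that by (auto simp flip: pM)
      thus ?thesis using sub by (auto simp: p_eq)
    qed
    moreover have "u i \<le> u (i + 1)" if "1 \<le> i" "i < n" for i
      using p_le[of i "i + 1"] that by auto
    moreover have "u i < u (i + 1)" if "1 \<le> i" "i < n" "\<sigma> i > \<sigma> (i + 1)" for i
    proof -
      have "key (i + 1) < key i" using that less_iff[of "i + 1" i] by auto
      thus ?thesis using p_le[of i "i + 1"] that by (auto simp: key_def)
    qed
    ultimately show ?thesis by (auto simp: compatible_def)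
  qed
  moreover have "image_mset (\<lambda>i. (restrict u {1..n} i, restrict u {1..n} (\<sigma> i))) (mset_set {1..n})
      = image_mset p (mset_set {1..n})"
    by (rule image_mset_cong) (use p_\<sigma> in_iff in \<open>auto simp: p_eq\<close>)
  ultimately show ?thesis using that pM by metis
qed

lemma card_Sigma_compatible:
  "card (Sigma (fpf_involutions n) (compatible n r)) = card (symmetric_multisets n r)"
proof (rule bij_betw_same_card)
  let ?f = "\<lambda>(\<sigma>, s). image_mset (\<lambda>i. (s i, s (\<sigma> i))) (mset_set {1..n})"
  have "?f ` Sigma (fpf_involutions n) (compatible n r) = symmetric_multisets n r"
  proof (intro equalityI subsetI)
    fix M assume "M \<in> symmetric_multisets n r"
    then show "M \<in> ?f ` Sigma (fpf_involutions n) (compatible n r)"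
      by (rule standardisation_surj) force
  qed (use pairs_symmetric in auto)
  thus "bij_betw ?f (Sigma (fpf_involutions n) (compatible n r)) (symmetric_multisets n r)"
    using standardisation_inj by (auto simp: bij_betw_def)
qed

lemma sum_fpf_involutions_choose:
  "(\<Sum>\<sigma>\<in>fpf_involutions (2 * m).
      if descents (2 * m) \<sigma> \<le> r then (r - descents (2 * m) \<sigma> + 2 * m choose (2 * m)) else 0)
   = (r * (r + 1) div 2 + m - 1 choose m)"
proof -
  have fin: "finite (compatible n r \<sigma>)" for n \<sigma>
    by (rule finite_subset[OF _ finite_PiE[of "{1..n}" "\<lambda>_. {0..r}"]]) (auto simp: compatible_def)
  show ?thesis
    using card_Sigma_compatible[of "2 * m" r] fin finite_fpf_involutions
    by (simp add: card_symmetric_multisets card_compatible)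
qed

section \<open>The recurrence for the descent numbers\<close>

text \<open>
  The number of descents is an integer argument here, so that shifted indices below zero occur
  freely in the recurrence and count nothing.
\<close>
definition descent_count :: "nat \<Rightarrow> int \<Rightarrow> int" where
  "descent_count m k = int (card {\<sigma>\<in>fpf_involutions (2 * m). int (descents (2 * m) \<sigma>) = k})"

text \<open>
  The binomial coefficient \<open>x + n choose n\<close>, cut off to zero for negative \<open>x\<close>.  For
  \<open>-n \<le> x < 0\<close> this agrees with the polynomial in \<open>x\<close>; the identities below stay within that
  range.
\<close>
definition choose_shift :: "nat \<Rightarrow> int \<Rightarrow> int" where
  "choose_shift n x = (if x < 0 then 0 else int (nat x + n choose n))"

lemma descent_count_neg: "k < 0 \<Longrightarrow> descent_count m k = 0"
  by (auto simp: descent_count_def)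

lemma descent_count_0: "descent_count 0 k = (if k = 0 then 1 else 0)"
proof -
  have "fpf_involutions (2 * 0) = {id}" by (auto simp: fpf_involutions_def)
  moreover have "descents (2 * 0) \<sigma> = 0" for \<sigma> by (simp add: descents_def)
  ultimately have "{\<sigma>\<in>fpf_involutions (2 * 0). int (descents (2 * 0) \<sigma>) = k} =
      (if k = 0 then {id} else {})" by auto
  thus ?thesis unfolding descent_count_def by simp
qed

lemma descent_count_sum:
  "(\<Sum>k=0..int r. descent_count m k * choose_shift (2 * m) (int r - k)) =
     int (r * (r + 1) div 2 + m - 1 choose m)"
proof -
  let ?n = "2 * m" and ?F = "fpf_involutions (2 * m)"
  let ?d = "\<lambda>\<sigma>. int (descents ?n \<sigma>)"
  have "(\<Sum>k=0..int r. descent_count m k * choose_shift ?n (int r - k)) =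
      (\<Sum>k=0..int r. \<Sum>\<sigma>\<in>?F. if ?d \<sigma> = k then choose_shift ?n (int r - k) else 0)"
    by (intro sum.cong refl)
       (simp add: descent_count_def sum.inter_filter[symmetric] finite_fpf_involutions)
  also have "\<dots> = (\<Sum>\<sigma>\<in>?F. \<Sum>k=0..int r. if ?d \<sigma> = k then choose_shift ?n (int r - k) else 0)"
    by (rule sum.swap)
  also have "\<dots> = (\<Sum>\<sigma>\<in>?F. int (if descents ?n \<sigma> \<le> r then (r - descents ?n \<sigma> + ?n choose ?n) else 0))"
    by (intro sum.cong refl)
       (auto simp: sum.delta' choose_shift_def nat_diff_distrib)
  also have "\<dots> = int (r * (r + 1) div 2 + m - 1 choose m)"
    using sum_fpf_involutions_choose[of m r] by (simp flip: of_nat_sum)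
  finally show ?thesis .
qed

lemma choose_shift_Suc:
  assumes "x \<ge> 0"
  shows "int (Suc n) * choose_shift (Suc n) x = (x + int n + 1) * choose_shift n x"
proof -
  have "Suc n * (Suc (nat x + n) choose Suc n) = Suc (nat x + n) * (nat x + n choose n)"
    by (rule Suc_times_binomial)
  hence "int (Suc n) * int (Suc (nat x + n) choose Suc n) =
      int (Suc (nat x + n)) * int (nat x + n choose n)"
    by (metis of_nat_mult)
  thus ?thesis using assms by (simp add: choose_shift_def algebra_simps del: binomial_Suc_Suc)
qed

lemma choose_shift_Suc_minus1:
  assumes "x \<ge> 0"
  shows "int (Suc n) * choose_shift (Suc n) (x - 1) = x * choose_shift n x"
proof (cases "x = 0")
  case False
  define y where "y = nat (x - 1)"
  have x: "x = int (Suc y)" using assms False by (simp add: y_def)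
  have absorb: "Suc n * (Suc (y + n) choose Suc n) = Suc (y + n) * (y + n choose n)"
    by (rule Suc_times_binomial)
  \<comment> \<open>The same absorption identity for the complementary lower index \<open>Suc y\<close>.\<close>
  have "Suc y * (Suc (y + n) choose n) = Suc (y + n) * (y + n choose n)"
    using Suc_times_binomial[of y "y + n"] binomial_symmetric[of n "Suc (y + n)"]
      binomial_symmetric[of n "y + n"] by (simp add: Suc_diff_le del: binomial_Suc_Suc)
  hence "int (Suc n) * int (Suc (y + n) choose Suc n) = int (Suc y) * int (Suc (y + n) choose n)"
    using absorb by (metis of_nat_mult)
  thus ?thesis using x by (simp add: choose_shift_def nat_add_distrib del: binomial_Suc_Suc)
qed (simp add: choose_shift_def)

text \<open>
  The functions \<open>r \<mapsto> choose_shift n (r - k)\<close> form a unitriangular system: each starts with the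
  value 1 at \<open>r = k\<close>.  Hence the coefficients of a combination are determined by its values.
\<close>
lemma choose_shift_triangular:
  assumes "\<And>r::nat. (\<Sum>k=0..int r. c k * choose_shift n (int r - k)) =
                      (\<Sum>k=0..int r. c' k * choose_shift n (int r - k))"
  shows "c (int j) = c' (int j)"
proof (induction j rule: less_induct)
  case (less j)
  have eq: "c k = c' k" if "k \<in> {0..<int j}" for k
    using less.IH[of "nat k"] that by auto
  have split: "{0..int j} = insert (int j) {0..<int j}" by auto
  have "choose_shift n 0 = 1" by (simp add: choose_shift_def)
  moreover have "(\<Sum>k=0..<int j. c k * choose_shift n (int j - k)) =
      (\<Sum>k=0..<int j. c' k * choose_shift n (int j - k))"
    by (rule sum.cong) (use eq in auto)
  ultimately show ?case
    using assms[of j] unfolding split by simp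
qed

lemma sum_shift_int:
  fixes f :: "int \<Rightarrow> int"
  assumes "f (-1) = 0" "f (int r) = 0"
  shows "(\<Sum>k=0..int r. f (k - 1)) = (\<Sum>k=0..int r. f k)"
proof -
  have "(\<Sum>k=0..int r. f (k - 1)) = (\<Sum>k\<in>{-1..int r - 1}. f k)"
    by (rule sum.reindex_bij_witness[of _ "\<lambda>k. k + 1" "\<lambda>k. k - 1"]) auto
  also have "\<dots> = (\<Sum>k\<in>{-1..int r}. f k)"
  proof (rule sum.mono_neutral_left)
    show "\<forall>k\<in>{-1..int r} - {-1..int r - 1}. f k = 0"
    proof
      fix k assume "k \<in> {-1..int r} - {-1..int r - 1}"
      hence "k = int r" by auto
      thus "f k = 0" using assms(2) by simp
    qed
  qed auto
  also have "\<dots> = (\<Sum>k=0..int r. f k)"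
  proof (rule sum.mono_neutral_right)
    show "\<forall>k\<in>{-1..int r} - {0..int r}. f k = 0"
    proof
      fix k assume "k \<in> {-1..int r} - {0..int r}"
      hence "k = -1" by auto
      thus "f k = 0" using assms(1) by simp
    qed
  qed auto
  finally show ?thesis .
qed

text \<open>
  Multiplication by the quadratic \<open>r(r+1) + n\<close> expressed in the basis for \<open>n + 2\<close>.  All terms are
  multiples of \<open>choose_shift n (r - k)\<close>, and what remains is an identity between quadratic
  polynomials.
\<close>
lemma choose_product_identity:
  fixes k r :: int and n :: nat
  assumes "k \<le> r"
  defines "N \<equiv> int n + 2"
  shows "(r * (r + 1) + int n) * choose_shift n (r - k) =
      (k * (k + 1) + int n) * choose_shift (n + 2) (r - k)
    + 2 * (k * (N - k - 2) + 1) * choose_shift (n + 2) (r - k - 1)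
    + ((N - k - 2) * (N - k - 1) + int n) * choose_shift (n + 2) (r - k - 2)"
    (is "?L = ?R")
proof -
  define x where "x = r - k"
  have x: "x \<ge> 0" "r = x + k" using assms by (auto simp: x_def)
  define C where "C = choose_shift n x"
  have 1: "N * (N - 1) * choose_shift (n + 2) x = (x + N) * (x + N - 1) * C"
  proof -
    have a: "N * choose_shift (n + 2) x = (x + N) * choose_shift (n + 1) x"
      using choose_shift_Suc[OF x(1), of "n + 1"] by (simp add: N_def add_ac)
    have b: "(N - 1) * choose_shift (n + 1) x = (x + N - 1) * C"
      using choose_shift_Suc[OF x(1), of n] by (simp add: N_def C_def add_ac)
    show ?thesis using a b by algebra
  qed
  have 2: "N * (N - 1) * choose_shift (n + 2) (x - 1) = x * (x + N - 1) * C"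
  proof -
    have a: "N * choose_shift (n + 2) (x - 1) = x * choose_shift (n + 1) x"
      using choose_shift_Suc_minus1[OF x(1), of "n + 1"] by (simp add: N_def add_ac)
    have b: "(N - 1) * choose_shift (n + 1) x = (x + N - 1) * C"
      using choose_shift_Suc[OF x(1), of n] by (simp add: N_def C_def add_ac)
    show ?thesis using a b by algebra
  qed
  have 3: "N * (N - 1) * choose_shift (n + 2) (x - 2) = x * (x - 1) * C"
  proof (cases "x = 0")
    case False
    hence "x - 1 \<ge> 0" using x by simp
    from choose_shift_Suc_minus1[OF this, of "n + 1"]
    have a: "N * choose_shift (n + 2) (x - 2) = (x - 1) * choose_shift (n + 1) (x - 1)"
      by (simp add: N_def add_ac)
    have b: "(N - 1) * choose_shift (n + 1) (x - 1) = x * C"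
      using choose_shift_Suc_minus1[OF x(1), of n] by (simp add: N_def C_def add_ac)
    show ?thesis using a b by algebra
  qed (simp add: choose_shift_def)
  have n: "int n = N - 2" by (simp add: N_def)
  have "N * (N - 1) * ?L = N * (N - 1) * ?R"
    unfolding x_def[symmetric] C_def[symmetric] n
    unfolding x(2) using 1 2 3 by algebra
  moreover have "N * (N - 1) \<noteq> 0" by (simp add: N_def)
  ultimately show ?thesis by simp
qed

text \<open>
  Both sides, summed against \<open>choose_shift (2 * m + 2) (r - k)\<close>, equal
  \<open>N * (r(r+1)/2 + m choose (m + 1))\<close> for every \<open>r\<close>: the left by the identity for \<open>m + 1\<close>, the right
  by the identity for \<open>m\<close> after the shifts of \<open>k\<close> are moved to the binomials and
  \<open>choose_product_identity\<close> collects them.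
\<close>
lemma descent_count_rec_nat:
  fixes m j :: nat
  defines "N \<equiv> 2 * int m + 2" and "k \<equiv> int j"
  shows "N * descent_count (m + 1) k =
      (k * (k + 1) + N - 2) * descent_count m k
    + 2 * ((k - 1) * (N - k - 1) + 1) * descent_count m (k - 1)
    + ((N - k) * (N - k + 1) + N - 2) * descent_count m (k - 2)"
proof -
  let ?a = "descent_count m" and ?B = "choose_shift (2 * m + 2)"
  define \<alpha> \<beta> \<gamma> where "\<alpha> k = k * (k + 1) + N - 2" and "\<beta> k = 2 * ((k - 1) * (N - k - 1) + 1)"
    and "\<gamma> k = (N - k) * (N - k + 1) + N - 2" for k
  define c where "c k = \<alpha> k * ?a k + \<beta> k * ?a (k - 1) + \<gamma> k * ?a (k - 2)" for k
  have "N * descent_count (m + 1) k = c k"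
    unfolding k_def
  proof (rule choose_shift_triangular[where c = "\<lambda>k. N * descent_count (m + 1) k" and c' = c])
    fix r :: nat
    define T where "T = r * (r + 1) div 2"
    have T: "2 * int T = int r * (int r + 1)"
    proof -
      have "2 * T = r * (r + 1)" unfolding T_def by (rule dvd_mult_div_cancel) simp
      hence "int (2 * T) = int (r * (r + 1))" by (rule arg_cong)
      thus ?thesis by (simp add: algebra_simps)
    qed
    \<comment> \<open>Shifting costs no boundary terms: \<open>?a (-1) = 0\<close> on the left, \<open>?B\<close> of a negative number on the right.\<close>
    have shift1: "(\<Sum>k=0..int r. \<beta> k * ?a (k - 1) * ?B (int r - k)) =
        (\<Sum>k=0..int r. \<beta> (k + 1) * ?a k * ?B (int r - k - 1))"
      using sum_shift_int[of "\<lambda>k. \<beta> (k + 1) * ?a k * ?B (int r - k - 1)" r]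
      by (simp add: descent_count_neg choose_shift_def)
    have shift2: "(\<Sum>k=0..int r. \<gamma> k * ?a (k - 2) * ?B (int r - k)) =
        (\<Sum>k=0..int r. \<gamma> (k + 2) * ?a k * ?B (int r - k - 2))"
    proof -
      have "(\<Sum>k=0..int r. \<gamma> k * ?a (k - 2) * ?B (int r - k)) =
          (\<Sum>k=0..int r. \<gamma> (k + 1) * ?a (k - 1) * ?B (int r - k - 1))"
        using sum_shift_int[of "\<lambda>k. \<gamma> (k + 1) * ?a (k - 1) * ?B (int r - k - 1)" r]
        by (simp add: descent_count_neg choose_shift_def)
      also have "\<dots> = (\<Sum>k=0..int r. \<gamma> (k + 2) * ?a k * ?B (int r - k - 2))"
        using sum_shift_int[of "\<lambda>k. \<gamma> (k + 2) * ?a k * ?B (int r - k - 2)" r]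
        by (simp add: descent_count_neg choose_shift_def algebra_simps)
      finally show ?thesis .
    qed
    have "(\<Sum>k=0..int r. c k * ?B (int r - k)) =
        (\<Sum>k=0..int r. \<alpha> k * ?a k * ?B (int r - k))
      + (\<Sum>k=0..int r. \<beta> k * ?a (k - 1) * ?B (int r - k))
      + (\<Sum>k=0..int r. \<gamma> k * ?a (k - 2) * ?B (int r - k))"
      by (simp add: c_def sum.distrib distrib_right)
    also have "\<dots> = (\<Sum>k=0..int r. ?a k * (\<alpha> k * ?B (int r - k)
        + \<beta> (k + 1) * ?B (int r - k - 1) + \<gamma> (k + 2) * ?B (int r - k - 2)))"
      unfolding shift1 shift2 by (simp add: sum.distrib distrib_left mult_ac)
    also have "\<dots> = (\<Sum>k=0..int r. ?a k *
        ((int r * (int r + 1) + 2 * int m) * choose_shift (2 * m) (int r - k)))"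
    proof (intro sum.cong refl arg_cong2[where f = "(*)"])
      fix k assume "k \<in> {0..int r}"
      hence "k \<le> int r" by simp
      from choose_product_identity[OF this, of "2 * m"]
      show "\<alpha> k * ?B (int r - k) + \<beta> (k + 1) * ?B (int r - k - 1) + \<gamma> (k + 2) * ?B (int r - k - 2)
          = (int r * (int r + 1) + 2 * int m) * choose_shift (2 * m) (int r - k)"
        by (simp add: \<alpha>_def \<beta>_def \<gamma>_def N_def algebra_simps)
    qed
    also have "\<dots> = (int r * (int r + 1) + 2 * int m) *
        (\<Sum>k=0..int r. ?a k * choose_shift (2 * m) (int r - k))"
      by (simp add: sum_distrib_left mult_ac)
    also have "\<dots> = 2 * (int (T + m) * int (T + m - 1 choose m))"
      unfolding descent_count_sum T[symmetric] T_def[symmetric] by simp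
    also have "int (T + m) * int (T + m - 1 choose m) = int (m + 1) * int (T + m choose (m + 1))"
    proof (cases "T + m")
      case (Suc p)
      have "Suc m * (Suc p choose Suc m) = Suc p * (p choose m)"
        by (rule Suc_times_binomial)
      hence "int (Suc m) * int (Suc p choose Suc m) = int (Suc p) * int (p choose m)"
        by (metis of_nat_mult)
      thus ?thesis unfolding Suc by (simp del: binomial_Suc_Suc)
    qed auto
    also have "2 * (int (m + 1) * int (T + m choose (m + 1))) =
        N * (\<Sum>k=0..int r. descent_count (m + 1) k * choose_shift (2 * (m + 1)) (int r - k))"
      unfolding descent_count_sum T_def[symmetric] by (simp add: N_def)
    finally show "(\<Sum>k=0..int r. N * descent_count (m + 1) k * ?B (int r - k)) =
        (\<Sum>k=0..int r. c k * ?B (int r - k))"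
      by (simp add: sum_distrib_left mult_ac)
  qed
  thus ?thesis by (simp add: c_def \<alpha>_def \<beta>_def \<gamma>_def)
qed

lemma descent_count_rec:
  fixes m :: nat and k :: int
  defines "N \<equiv> 2 * int m + 2"
  shows "N * descent_count (m + 1) k =
      (k * (k + 1) + N - 2) * descent_count m k
    + 2 * ((k - 1) * (N - k - 1) + 1) * descent_count m (k - 1)
    + ((N - k) * (N - k + 1) + N - 2) * descent_count m (k - 2)"
proof (cases "k < 0")
  case False
  thus ?thesis using descent_count_rec_nat[of m "nat k"] by (simp add: N_def)
qed (simp add: descent_count_neg)

section \<open>Symmetry and unimodality\<close>

lemma descent_count_symmetric: "descent_count m (2 * int m - k) = descent_count m k"
proof (induction m arbitrary: k)
  case 0
  show ?case by (auto simp: descent_count_0)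
next
  case (Suc m)
  define N where "N = 2 * int m + 2"
  have s: "descent_count m (N - k) = descent_count m (k - 2)"
    "descent_count m (N - k - 1) = descent_count m (k - 1)"
    "descent_count m (N - k - 2) = descent_count m k"
    using Suc.IH[of "k - 2"] Suc.IH[of "k - 1"] Suc.IH[of k] by (simp_all add: N_def algebra_simps)
  have "N * descent_count (m + 1) (N - k) = N * descent_count (m + 1) k"
    using descent_count_rec[of m k] descent_count_rec[of m "N - k"]
    unfolding N_def[symmetric] s by algebra
  moreover have "N \<noteq> 0" by (simp add: N_def)
  ultimately show ?case by (simp add: N_def add.commute)
qed

definition descent_diff :: "nat \<Rightarrow> int \<Rightarrow> int" where
  "descent_diff m k = descent_count m k - descent_count m (k - 1)"

text \<open>
  The left-over terms cancel because the three coefficients of the recurrence at \<open>k\<close> have the same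
  sum as those at \<open>k - 1\<close>.
\<close>
lemma descent_diff_rec:
  fixes m :: nat and k :: int
  defines "N \<equiv> 2 * int m + 2"
  shows "N * descent_diff (m + 1) k =
      (k * (k + 1) + N - 2) * descent_diff m k
    + 2 * (k + (k - 1) * (N - k - 1) + 1) * descent_diff m (k - 1)
    + ((N - k + 1) * (N - k + 2) + N - 2) * descent_diff m (k - 2)"
proof -
  have *: "k - 1 - 1 = k - 2" "k - 1 - 2 = k - 3" "k - 2 - 1 = k - 3" by auto
  show ?thesis
    using descent_count_rec[of m k] descent_count_rec[of m "k - 1"]
    unfolding N_def[symmetric] descent_diff_def * by algebra
qed

lemma descent_count_at_0: "m \<ge> 1 \<Longrightarrow> descent_count m 0 = 0"
proof (induction m rule: nat_induct_at_least)
  case base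
  show ?case using descent_count_rec[of 0 0] by (simp add: descent_count_0)
next
  case (Suc m)
  show ?case using descent_count_rec[of m 0] Suc by (simp add: descent_count_neg)
qed

lemma descent_diff_nonpos_index: "m \<ge> 1 \<Longrightarrow> k \<le> 0 \<Longrightarrow> descent_diff m k = 0"
  by (cases "k = 0") (auto simp: descent_diff_def descent_count_neg descent_count_at_0)

lemma descent_diff_symmetric:
  "descent_diff m (2 * int m + 1 - k) = - descent_diff m k"
  using descent_count_symmetric[of m k] descent_count_symmetric[of m "k - 1"]
  by (simp add: descent_diff_def algebra_simps)

text \<open>
  At the middle of row \<open>m + 1\<close> the recurrence involves the first difference past the centre of row
  \<open>m\<close>, which is negative.  By symmetry it is the negative of the last difference before the centre,
  and merging the two leaves the nonnegative coefficient \<open>(m - 1)(m - 2)\<close>.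
\<close>
lemma descent_diff_rec_middle:
  fixes m :: nat
  defines "k \<equiv> int m + 1"
  shows "(2 * int m + 2) * descent_diff (m + 1) k =
      (int m - 1) * (int m - 2) * descent_diff m (k - 1)
    + ((int m + 2) * (int m + 3) + 2 * int m) * descent_diff m (k - 2)"
proof -
  have "descent_diff m k = - descent_diff m (k - 1)"
    using descent_diff_symmetric[of m "k - 1"] by (simp add: k_def)
  thus ?thesis
    using descent_diff_rec[of m k] unfolding k_def by (simp add: algebra_simps)
qed

text \<open>
  The induction starts at \<open>m = 3\<close>, where the counts are 1, 3, 7, since for \<open>m = 2\<close> they are
  1, 1, 1.
\<close>
lemma descent_diff_pos:
  assumes "m \<ge> 3" "1 \<le> k" "k \<le> int m"
  shows "descent_diff m k > 0"
  using assms
proof (induction m arbitrary: k rule: nat_induct_at_least)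
  case base
  have d1: "descent_diff 1 1 = 1"
    using descent_diff_rec[of 0 1] by (simp add: descent_diff_def descent_count_0)
  have z: "descent_diff 1 j = 0" "descent_diff 2 j = 0" if "j \<le> 0" for j
    using that descent_diff_nonpos_index by auto
  have d2: "descent_diff 2 1 = 1" "descent_diff 2 2 = 0"
    using descent_diff_rec[of 1 1] descent_diff_rec_middle[of 1] d1 z
    by (simp_all add: numeral_2_eq_2)
  have "descent_diff 3 1 = 1" "descent_diff 3 2 = 2" "descent_diff 3 3 = 4"
    using descent_diff_rec[of 2 1] descent_diff_rec[of 2 2] descent_diff_rec_middle[of 2] d2 z
    by simp_all
  hence pos: "descent_diff 3 1 > 0" "descent_diff 3 2 > 0" "descent_diff 3 3 > 0" by simp_all
  have "k = 1 \<or> k = 2 \<or> k = 3" using base by auto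
  thus ?case using pos by blast
next
  case (Suc m)
  show ?case
  proof (cases "k = int m + 1")
    case True
    have "descent_diff m (k - 1) > 0" "descent_diff m (k - 2) > 0"
      using Suc.IH[of "k - 1"] Suc.IH[of "k - 2"] Suc.hyps True by auto
    hence "(2 * int m + 2) * descent_diff (m + 1) k > 0"
      using Suc.hyps unfolding True descent_diff_rec_middle
      by (intro add_nonneg_pos mult_nonneg_nonneg mult_pos_pos) auto
    thus ?thesis by (simp add: zero_less_mult_iff)
  next
    case False
    hence k: "1 \<le> k" "k \<le> int m" using Suc.prems by auto
    have nonneg: "descent_diff m j \<ge> 0" if "j \<le> k" for j
      using Suc.IH[of j] descent_diff_nonpos_index[of m j] Suc.hyps k that by fastforce
    have "k * (k + 1) + (2 * int m + 2) - 2 > 0"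
      using k by (simp add: add_pos_nonneg)
    hence "(2 * int m + 2) * descent_diff (m + 1) k > 0"
      unfolding descent_diff_rec
      using k nonneg Suc.IH[OF k]
      by (intro add_pos_nonneg mult_nonneg_nonneg mult_pos_pos) auto
    thus ?thesis by (simp add: zero_less_mult_iff)
  qed
qed

lemma coeff_descent_poly: "coeff (descent_poly (2 * m)) k = descent_count m (int k)"
  by (simp add: descent_poly_def coeff_sum descent_count_def sum.inter_filter[symmetric]
      finite_fpf_involutions)

theorem theorem2p6:
  fixes n i :: nat
  assumes "n \<ge> 2" and "even n"
    and "1 \<le> i" and "real i \<le> real n powr 0.925 / 10"
  shows "coeff (descent_poly n) i < coeff (descent_poly n) (i + 1)
    \<and> coeff (descent_poly n) (n - 1 - i) > coeff (descent_poly n) (n - i)"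
proof -
  obtain m where n: "n = 2 * m" using \<open>even n\<close> by (elim evenE)
  have "real n powr 0.925 \<le> real n powr 1"
    using assms(1) by (intro powr_mono) auto
  hence "10 * real i \<le> real n" using assms by simp
  hence "10 * i \<le> n" by linarith
  hence m: "m \<ge> 3" "i + 1 \<le> m" using n \<open>1 \<le> i\<close> by auto
  have less: "descent_count m (int i) < descent_count m (int i + 1)"
    using descent_diff_pos[of m "int i + 1"] m by (simp add: descent_diff_def)
  have "descent_count m (int (n - i)) = descent_count m (int i)"
    using descent_count_symmetric[of m "int i"] m n by (simp add: of_nat_diff)
  moreover have "descent_count m (int (n - 1 - i)) = descent_count m (int i + 1)"
    using descent_count_symmetric[of m "int i + 1"] m n by (simp add: of_nat_diff algebra_simps)
  ultimately show ?thesis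
    using less unfolding n coeff_descent_poly of_nat_add of_nat_1 by metis
qed

end
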